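(* There is an algorithm which, given $\varepsilon\in(0,1)$ and \textsc{Cond} access to an arbitrary distribution $\mathcal{D}$ over $[N]$, makes $\tilde{O}(\varepsilon^{-4})$ queries and satisfies: if $\mathcal{D}$ is monotone it outputs ACCEPT with probability at least $2/3$, and if $d_{\mathrm{TV}}(\mathcal{D},\mathcal{D}')\ge\varepsilon$ for every monotone distribution $\mathcal{D}'$ over $[N]$ it outputs REJECT with probability at least $2/3$.
   Context: A distribution $\mathcal{D}$ over $[N]$ with $D(i)=\Pr_{x\sim\mathcal{D}}(x=i)$ is monotone if $D(1)\ge D(2)\ge\cdots\ge D(N)$. The \textsc{Cond} oracle takes $S\subseteq[N]$ and returns $i\in S$ with probability $D(i)/D(S)$ (where $D(S)=\sum_{i\in S}D(i)$), independently of previous calls. $d_{\mathrm{TV}}(\mathcal{D}_1,\mathcal{D}_2)=\frac12\sum_i|D_1(i)-D_2(i)|$. $\tilde O(\cdot)$ hides factors polylogarithmic in $1/\varepsilon$. *)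

theory Defs
  imports "HOL-Probability.Probability"
begin

text \<open>The domain \<open>[N]\<close> is the set \<open>{1..N}\<close>; a distribution over it is a
  \<^typ>\<open>nat pmf\<close> supported there, so \<open>D(i)\<close> is \<open>pmf D i\<close> and \<open>D(S)\<close> is
  \<open>measure_pmf.prob D S\<close>.\<close>

definition distributions :: "nat \<Rightarrow> nat pmf set" where
  "distributions N = {D. set_pmf D \<subseteq> {1..N}}"

definition monotone_distributions :: "nat \<Rightarrow> nat pmf set" where
  "monotone_distributions N =
     {D \<in> distributions N. \<forall>i\<in>{1..N}. \<forall>j\<in>{1..N}. i \<le> j \<longrightarrow> pmf D j \<le> pmf D i}"

definition dTV :: "nat \<Rightarrow> nat pmf \<Rightarrow> nat pmf \<Rightarrow> real" where
  "dTV N D1 D2 = (1/2) * (\<Sum>i\<in>{1..N}. \<bar>pmf D1 i - pmf D2 i\<bar>)"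

text \<open>The formula \<open>D(i)/D(S)\<close> says nothing when \<open>D(S) = 0\<close>. On such a query the answer may
  follow any distribution on \<open>S\<close>; a tester has to cope with every oracle of this kind.\<close>

definition cond_oracle :: "nat \<Rightarrow> nat pmf \<Rightarrow> (nat set \<Rightarrow> nat pmf) \<Rightarrow> bool" where
  "cond_oracle N D orc \<longleftrightarrow>
     (\<forall>S. S \<subseteq> {1..N} \<and> S \<noteq> {} \<longrightarrow>
        set_pmf (orc S) \<subseteq> S \<and>
        (measure_pmf.prob D S > 0 \<longrightarrow>
           (\<forall>i\<in>S. pmf (orc S) i = pmf D i / measure_pmf.prob D S)))"

datatype verdict = ACCEPT | REJECT

text \<open>Adaptive randomized query algorithms, as well-founded decision trees: stop with a verdict,
  query a set and continue depending on the answer, or draw internal randomness.\<close>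

datatype query_alg =
    Output verdict
  | Query "nat set" "nat \<Rightarrow> query_alg"
  | Random "nat pmf" "nat \<Rightarrow> query_alg"

text \<open>Every query draws a fresh sample from \<open>orc S\<close>, independent of all earlier answers.\<close>

primrec run :: "(nat set \<Rightarrow> nat pmf) \<Rightarrow> query_alg \<Rightarrow> verdict pmf" where
  "run orc (Output v) = return_pmf v"
| "run orc (Query S k) = bind_pmf (orc S) (\<lambda>i. run orc (k i))"
| "run orc (Random p k) = bind_pmf p (\<lambda>x. run orc (k x))"

text \<open>In the worst case over all answers and all internal randomness, the algorithm makes at most
  \<open>q\<close> queries, each of them to a nonempty subset of \<open>[N]\<close>.\<close>

primrec queries_at_most :: "nat \<Rightarrow> query_alg \<Rightarrow> nat \<Rightarrow> bool" where
  "queries_at_most N (Output v) q \<longleftrightarrow> True"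
| "queries_at_most N (Query S k) q \<longleftrightarrow>
     q \<ge> 1 \<and> S \<subseteq> {1..N} \<and> S \<noteq> {} \<and> (\<forall>i\<in>S. queries_at_most N (k i) (q - 1))"
| "queries_at_most N (Random p k) q \<longleftrightarrow> (\<forall>x\<in>set_pmf p. queries_at_most N (k x) q)"

text \<open>\<open>f(\<epsilon>) = O~(g(\<epsilon>))\<close>, hiding factors polylogarithmic in \<open>1/\<epsilon>\<close>, uniformly over the whole
  range \<open>0 < \<epsilon> < 1\<close>. The summand \<open>1\<close> keeps the logarithmic factor from vanishing as
  \<open>\<epsilon>\<close> tends to \<open>1\<close>.\<close>

definition soft_O :: "(real \<Rightarrow> real) \<Rightarrow> (real \<Rightarrow> real) set" where
  "soft_O g = {f. \<exists>C::real. \<exists>k::nat. \<forall>\<epsilon>\<in>{0<..<1}.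
                    \<bar>f \<epsilon>\<bar> \<le> C * \<bar>g \<epsilon>\<bar> * (1 + ln (1 / \<epsilon>)) ^ k}"

end

theory Submission
  imports Defs
begin

text \<open>A trial draws \<open>x\<close> from \<open>D\<close> and a partner \<open>y\<close> uniformly from a window around \<open>x\<close>, which
  reaches \<open>x/2\<^sup>t\<close> to the left for a random scale \<open>t \<le> b\<close> but only \<open>x/2\<^sup>b\<close> to the right; it then
  estimates \<open>D(y)/(D(x)+D(y))\<close> from queries to \<open>{x,y}\<close> and rejects if \<open>D(y)\<close> appears to be below
  \<open>D(x)\<close> by a relative amount \<open>\<eta>\<close>. The quantity that decides is the expected violation
  \<open>\<Sum>\<^sub>x\<^sub>,\<^sub>y K(x,y) max(0, D(x) - D(y))\<close>, with \<open>K(x,y)\<close> the probability that \<open>y\<close> is chosen as the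
  partner of \<open>x\<close>. It is additive over the superlevel sets of \<open>D\<close>, so both bounds on it reduce to
  \<open>0/1\<close>-valued functions.

  If \<open>D\<close> is monotone, only partners \<open>y > x\<close> contribute; the points of a set \<open>{1..M}\<close> that can reach
  beyond \<open>M\<close> number at most \<open>M/2\<^sup>b\<close>, and the violation is at most \<open>2\<^sup>-\<^sup>b\<close>. Conversely, for a
  \<open>0/1\<close>-valued function remove disjoint pairs \<open>i < j\<close> with values \<open>0\<close> at \<open>i\<close> and \<open>1\<close> at \<open>j\<close>
  until none is left: the rest is monotone, and each removed pair accounts for a violation of order
  \<open>1/b\<close>, since every \<open>y\<close> in a suitable window disagrees with \<open>i\<close> or with \<open>j\<close>. A distribution that is
  \<open>\<epsilon>\<close>-far from monotone thus has violation of order \<open>\<epsilon>/b\<close>. With \<open>b\<close> of order \<open>log(1/\<epsilon>)\<close> and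
  \<open>\<eta>\<close> of order \<open>\<epsilon>/b\<close>, there are \<open>O(1/\<eta>)\<close> trials of \<open>O(1/\<eta>\<^sup>3)\<close> queries each.\<close>

section \<open>Distance to monotonicity and violated pairs\<close>

text \<open>A nonnegative function on a finite set loses a point of its support when the multiple of the
  support's indicator with its least positive value is subtracted.\<close>

lemma layer_induct [consumes 2, case_names zero layer]:
  fixes f :: "'a \<Rightarrow> real"
  assumes "finite X" and "\<forall>x\<in>X. f x \<ge> 0"
    and zero: "\<And>f. (\<And>x. x \<in> X \<Longrightarrow> f x = 0) \<Longrightarrow> P f"
    and layer: "\<And>f g S \<delta>. \<delta> > 0 \<Longrightarrow> S = {x \<in> X. f x > 0} \<Longrightarrow>
                  (\<And>x. x \<in> X \<Longrightarrow> f x = g x + \<delta> * of_bool (x \<in> S)) \<Longrightarrow>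
                  (\<And>x. x \<in> X \<Longrightarrow> g x \<ge> 0) \<Longrightarrow>
                  (\<And>x. x \<in> X - S \<Longrightarrow> g x = 0) \<Longrightarrow> P g \<Longrightarrow> P f"
  shows "P f"
  using assms(2)
proof (induction "card {x \<in> X. f x > 0}" arbitrary: f rule: less_induct)
  case less
  define S where "S = {x \<in> X. f x > 0}"
  have finS: "finite S" using \<open>finite X\<close> by (simp add: S_def)
  show ?case
  proof (cases "S = {}")
    case True
    then have "f x = 0" if "x \<in> X" for x
      using bspec[OF less.prems that] that by (force simp: S_def)
    then show ?thesis by (rule zero)
  next
    case False
    define \<delta> where "\<delta> = Min (f ` S)"
    define g where "g x = f x - \<delta> * of_bool (x \<in> S)" for x
    have "\<delta> \<in> f ` S" using False finS by (simp add: \<delta>_def)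
    then obtain m where m: "m \<in> S" "f m = \<delta>" by auto
    have le: "\<delta> \<le> f x" if "x \<in> S" for x
      using that finS by (simp add: \<delta>_def)
    have pos: "\<delta> > 0" using m by (auto simp: S_def)
    have g0: "g x \<ge> 0" if "x \<in> X" for x
      using bspec[OF less.prems that] le[of x] by (auto simp: g_def)
    have gout: "g x = 0" if "x \<in> X - S" for x
      using bspec[OF less.prems, of x] that by (auto simp: g_def S_def)
    have "{x \<in> X. g x > 0} \<subset> S"
    proof
      show "{x \<in> X. g x > 0} \<subseteq> S" using gout by force
      have "g m = 0" using m by (simp add: g_def)
      then show "{x \<in> X. g x > 0} \<noteq> S" using m by auto
    qed
    then have "card {x \<in> X. g x > 0} < card S"
      using finS by (rule psubset_card_mono[rotated])
    then have "P g" using less.hyps g0 by (simp add: S_def)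
    then show ?thesis
      using layer[OF pos S_def, of g] g0 gout by (simp add: g_def)
  qed
qed

text \<open>Inside \<open>S\<close> the shifts by \<open>\<delta>\<close> cancel; if
  \<open>x \<in> S\<close> and \<open>y \<notin> S\<close>, then \<open>g y = 0\<close> and no
  truncation occurs; if \<open>x \<notin> S\<close>, both positive parts vanish. This makes the
  violation additive over layers.\<close>

lemma max_diff_layer:
  fixes \<delta> :: real
  assumes "\<delta> \<ge> 0" "g x \<ge> 0" "g y \<ge> 0" "x \<notin> S \<Longrightarrow> g x = 0" "y \<notin> S \<Longrightarrow> g y = 0"
  shows "max 0 ((g x + \<delta> * of_bool (x \<in> S)) - (g y + \<delta> * of_bool (y \<in> S))) =
         max 0 (g x - g y) + \<delta> * of_bool (x \<in> S \<and> y \<notin> S)"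
  using assms by (auto simp: max_def)

text \<open>The down-set \<open>C\<close> stands for a monotone 0/1 function approximating
  \<open>S\<close>. Discarding an inverted pair concedes at most two mismatches and is paid for by
  \<open>\<phi> i + \<phi> j\<close>. The discarded pairs are disjoint, so each charge is spent
  once, and the factor 2 results.\<close>

lemma ex_cut_few_mismatches:
  fixes \<phi> :: "'a::linorder \<Rightarrow> real" and \<kappa> :: real
  assumes "finite A" and "\<kappa> \<ge> 0" and "\<And>v. v \<in> A \<Longrightarrow> \<phi> v \<ge> 0"
    and "\<And>i j. \<lbrakk>i \<in> A; j \<in> A; i < j; i \<notin> S; j \<in> S\<rbrakk> \<Longrightarrow> \<kappa> \<le> \<phi> i + \<phi> j"
  shows "\<exists>C. (\<forall>x y. x \<le> y \<longrightarrow> y \<in> C \<longrightarrow> x \<in> C) \<and>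
             \<kappa> * card {x \<in> A. (x \<in> S) \<noteq> (x \<in> C)} \<le> 2 * sum \<phi> A"
  using assms(1,3,4)
proof (induction A rule: finite_psubset_induct)
  case (psubset A)
  show ?case
  proof (cases "\<exists>i\<in>A. \<exists>j\<in>A. i < j \<and> i \<notin> S \<and> j \<in> S")
    case False
    \<comment> \<open>Without inversions in \<open>A\<close>, the down-closure of
      \<open>A \<inter> S\<close> agrees with \<open>S\<close> on all of \<open>A\<close>.\<close>
    define C where "C = {x. \<exists>y\<in>A \<inter> S. x \<le> y}"
    have "{x \<in> A. (x \<in> S) \<noteq> (x \<in> C)} = {}"
      using False by (fastforce simp: C_def order.order_iff_strict)
    moreover have "sum \<phi> A \<ge> 0" by (intro sum_nonneg psubset.prems)
    ultimately have "\<kappa> * card {x \<in> A. (x \<in> S) \<noteq> (x \<in> C)} \<le> 2 * sum \<phi> A"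
      by (metis card.empty mult_nonneg_nonneg mult_zero_right of_nat_0 zero_le_numeral)
    moreover have "\<forall>x y. x \<le> y \<longrightarrow> y \<in> C \<longrightarrow> x \<in> C"
      unfolding C_def by (blast intro: order.trans)
    ultimately show ?thesis by blast
  next
    case True
    then obtain i j where ij: "i \<in> A" "j \<in> A" "i < j" "i \<notin> S" "j \<in> S" by blast
    define B where "B = A - {i, j}"
    have "B \<subset> A" using ij by (auto simp: B_def)
    then obtain C where C: "\<forall>x y. x \<le> y \<longrightarrow> y \<in> C \<longrightarrow> x \<in> C"
      "\<kappa> * card {x \<in> B. (x \<in> S) \<noteq> (x \<in> C)} \<le> 2 * sum \<phi> B"
      using psubset.IH[of B] psubset.prems by blast
    have "{x \<in> A. (x \<in> S) \<noteq> (x \<in> C)} \<subseteq> {x \<in> B. (x \<in> S) \<noteq> (x \<in> C)} \<union> {i, j}"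
      by (auto simp: B_def)
    then have "card {x \<in> A. (x \<in> S) \<noteq> (x \<in> C)} \<le> card ({x \<in> B. (x \<in> S) \<noteq> (x \<in> C)} \<union> {i, j})"
      using psubset.hyps by (intro card_mono) (auto simp: B_def)
    also have "\<dots> \<le> card {x \<in> B. (x \<in> S) \<noteq> (x \<in> C)} + card {i, j}"
      by (rule card_Un_le)
    also have "card {i, j} = 2" using ij by auto
    finally have "\<kappa> * card {x \<in> A. (x \<in> S) \<noteq> (x \<in> C)} \<le>
        \<kappa> * real (card {x \<in> B. (x \<in> S) \<noteq> (x \<in> C)} + 2)"
      using \<open>\<kappa> \<ge> 0\<close> by (intro mult_left_mono) (simp_all only: of_nat_le_iff)
    also have "\<dots> \<le> 2 * sum \<phi> B + 2 * (\<phi> i + \<phi> j)"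
      using C(2) psubset.prems(2)[OF ij] by (simp add: algebra_simps)
    also have "\<dots> = 2 * sum \<phi> A"
    proof -
      have "sum \<phi> A = sum \<phi> B + sum \<phi> {i, j}"
        unfolding B_def using ij psubset.hyps by (intro sum.subset_diff) auto
      then show ?thesis using ij by simp
    qed
    finally show ?thesis using C(1) by blast
  qed
qed

text \<open>Each layer \<open>S\<close> of \<open>f\<close> is replaced by a down-set
  \<open>C\<close> close to it, and \<open>g\<close> is the weighted sum of these down-sets. The 4
  combines the 2 lost per removed pair with the 2 from charging a violation at both ends. The mass
  of \<open>g\<close> is not controlled here.\<close>

lemma ex_antimono_close:
  fixes K :: "'a::linorder \<Rightarrow> 'a \<Rightarrow> real" and f :: "'a \<Rightarrow> real"
  assumes "finite X" and f0: "\<forall>x\<in>X. f x \<ge> 0"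
    and \<kappa>: "\<kappa> \<ge> 0" and K: "\<And>x y. K x y \<ge> 0"
    and pair: "\<And>S i j. \<lbrakk>i \<in> X; j \<in> X; i < j; i \<notin> S; j \<in> S\<rbrakk> \<Longrightarrow>
       \<kappa> \<le> (\<Sum>y\<in>X. K j y * of_bool (y \<notin> S)) + (\<Sum>y\<in>X. K y i * of_bool (y \<in> S))"
  shows "\<exists>g. antimono g \<and> (\<forall>x. g x \<ge> 0) \<and>
    \<kappa> * (\<Sum>x\<in>X. \<bar>f x - g x\<bar>) \<le> 4 * (\<Sum>x\<in>X. \<Sum>y\<in>X. K x y * max 0 (f x - f y))"
  using assms(1,2)
proof (induction f rule: layer_induct)
  case (zero f)
  then show ?case
    by (intro exI[of _ "\<lambda>_. 0"]) (simp add: monotone_on_def)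
next
  case (layer f f' S \<delta>)
  from layer.IH obtain g where g: "antimono g" "\<forall>x. g x \<ge> 0"
    "\<kappa> * (\<Sum>x\<in>X. \<bar>f' x - g x\<bar>) \<le> 4 * (\<Sum>x\<in>X. \<Sum>y\<in>X. K x y * max 0 (f' x - f' y))"
    by blast
  \<comment> \<open>\<open>\<phi> v\<close> charges a violation to both of its ends, hence \<open>sum \<phi> X\<close> is twice the total \<open>E\<close>.\<close>
  define \<phi> where "\<phi> v = (if v \<in> S then \<Sum>y\<in>X. K v y * of_bool (y \<notin> S)
                                    else \<Sum>y\<in>X. K y v * of_bool (y \<in> S))" for v
  define E where "E = (\<Sum>x\<in>X. \<Sum>y\<in>X. K x y * of_bool (x \<in> S \<and> y \<notin> S))"
  have "\<exists>C. (\<forall>x y. x \<le> y \<longrightarrow> y \<in> C \<longrightarrow> x \<in> C) \<and>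
             \<kappa> * card {x \<in> X. (x \<in> S) \<noteq> (x \<in> C)} \<le> 2 * sum \<phi> X"
  proof (rule ex_cut_few_mismatches)
    show "\<phi> v \<ge> 0" for v
      by (auto simp: \<phi>_def K intro!: sum_nonneg mult_nonneg_nonneg)
    show "\<kappa> \<le> \<phi> i + \<phi> j" if "i \<in> X" "j \<in> X" "i < j" "i \<notin> S" "j \<in> S" for i j
      using pair[OF that] that by (simp add: \<phi>_def)
  qed (use \<open>finite X\<close> \<kappa> in auto)
  then obtain C where C: "\<forall>x y. x \<le> y \<longrightarrow> y \<in> C \<longrightarrow> x \<in> C"
    "\<kappa> * card {x \<in> X. (x \<in> S) \<noteq> (x \<in> C)} \<le> 2 * sum \<phi> X" by blast
  have "sum \<phi> X = (\<Sum>v\<in>X. \<Sum>y\<in>X. K v y * of_bool (v \<in> S \<and> y \<notin> S)) +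
                  (\<Sum>v\<in>X. \<Sum>y\<in>X. K y v * of_bool (y \<in> S \<and> v \<notin> S))"
    unfolding sum.distrib[symmetric] by (intro sum.cong refl) (simp add: \<phi>_def)
  also have "(\<Sum>v\<in>X. \<Sum>y\<in>X. K y v * of_bool (y \<in> S \<and> v \<notin> S)) = E"
    unfolding E_def by (rule sum.swap)
  finally have \<phi>E: "sum \<phi> X = 2 * E" by (simp add: E_def)
  have mis: "(\<Sum>x\<in>X. \<bar>of_bool (x \<in> S) - of_bool (x \<in> C) :: real\<bar>) =
             card {x \<in> X. (x \<in> S) \<noteq> (x \<in> C)}"
  proof -
    have "(\<Sum>x\<in>X. \<bar>of_bool (x \<in> S) - of_bool (x \<in> C) :: real\<bar>) =
          (\<Sum>x\<in>X. of_bool ((x \<in> S) \<noteq> (x \<in> C)))"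
      by (intro sum.cong) auto
    then show ?thesis using \<open>finite X\<close> by (simp add: Int_def)
  qed
  \<comment> \<open>The cuts of different layers need not be nested: a sum of antimonotone functions
    is antimonotone in any case.\<close>
  define h where "h x = g x + \<delta> * of_bool (x \<in> C)" for x
  have "(\<Sum>x\<in>X. \<bar>f x - h x\<bar>) \<le>
        (\<Sum>x\<in>X. \<bar>f' x - g x\<bar> + \<delta> * \<bar>of_bool (x \<in> S) - of_bool (x \<in> C)\<bar>)"
  proof (intro sum_mono)
    fix x assume "x \<in> X"
    have "f x - h x = (f' x - g x) + \<delta> * (of_bool (x \<in> S) - of_bool (x \<in> C))"
      using layer.hyps(3)[OF \<open>x \<in> X\<close>] by (simp add: h_def algebra_simps)
    then show "\<bar>f x - h x\<bar> \<le> \<bar>f' x - g x\<bar> + \<delta> * \<bar>of_bool (x \<in> S) - of_bool (x \<in> C)\<bar>"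
      using \<open>\<delta> > 0\<close> by (metis abs_mult abs_of_pos abs_triangle_ineq)
  qed
  also have "\<dots> = (\<Sum>x\<in>X. \<bar>f' x - g x\<bar>) + \<delta> * card {x \<in> X. (x \<in> S) \<noteq> (x \<in> C)}"
    by (simp add: sum.distrib mis flip: sum_distrib_left)
  finally have "\<kappa> * (\<Sum>x\<in>X. \<bar>f x - h x\<bar>) \<le>
      \<kappa> * (\<Sum>x\<in>X. \<bar>f' x - g x\<bar>) + \<delta> * (\<kappa> * card {x \<in> X. (x \<in> S) \<noteq> (x \<in> C)})"
    using \<kappa> by (metis (no_types, lifting) distrib_left mult.left_commute mult_left_mono)
  also have "\<dots> \<le> 4 * (\<Sum>x\<in>X. \<Sum>y\<in>X. K x y * max 0 (f' x - f' y)) + \<delta> * (4 * E)"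
    using g(3) C(2) \<phi>E \<open>\<delta> > 0\<close> by (intro add_mono mult_left_mono) auto
  also have "\<dots> = 4 * (\<Sum>x\<in>X. \<Sum>y\<in>X. K x y * max 0 (f x - f y))"
  proof -
    have "max 0 (f x - f y) = max 0 (f' x - f' y) + \<delta> * of_bool (x \<in> S \<and> y \<notin> S)"
      if "x \<in> X" "y \<in> X" for x y
      using that layer.hyps(1,3,4,5) max_diff_layer[of \<delta> f' x y S] by auto
    then have "(\<Sum>x\<in>X. \<Sum>y\<in>X. K x y * max 0 (f x - f y)) =
       (\<Sum>x\<in>X. \<Sum>y\<in>X. K x y * max 0 (f' x - f' y) + \<delta> * (K x y * of_bool (x \<in> S \<and> y \<notin> S)))"
      by (intro sum.cong refl) (simp add: algebra_simps)
    then show ?thesis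
      by (simp add: sum.distrib E_def algebra_simps flip: sum_distrib_left)
  qed
  finally have "\<kappa> * (\<Sum>x\<in>X. \<bar>f x - h x\<bar>) \<le> 4 * (\<Sum>x\<in>X. \<Sum>y\<in>X. K x y * max 0 (f x - f y))" .
  moreover have "antimono h"
    using g(1) C(1) \<open>\<delta> > 0\<close> unfolding h_def monotone_on_def
    by (auto intro: add_increasing2)
  moreover have "\<forall>x. h x \<ge> 0" using g(2) \<open>\<delta> > 0\<close> by (simp add: h_def)
  ultimately show ?case by blast
qed

text \<open>Every layer of a decreasing function is an initial segment \<open>{1..M}\<close> of some
  height \<open>\<delta>\<close>. It adds \<open>\<delta>\<close> times the kernel mass leaving the
  segment to the violation, and \<open>\<delta> * M\<close> to the sum of \<open>f\<close>.\<close>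

lemma antimono_violation_le:
  fixes K :: "nat \<Rightarrow> nat \<Rightarrow> real" and f :: "nat \<Rightarrow> real"
  assumes f0: "\<forall>x\<in>{1..N}. f x \<ge> 0"
    and mono: "\<forall>x\<in>{1..N}. \<forall>y\<in>{1..N}. x \<le> y \<longrightarrow> f y \<le> f x"
    and step: "\<And>M. M \<le> N \<Longrightarrow> (\<Sum>x\<in>{1..M}. \<Sum>y\<in>{M<..N}. K x y) \<le> \<beta> * M"
  shows "(\<Sum>x\<in>{1..N}. \<Sum>y\<in>{1..N}. K x y * max 0 (f x - f y)) \<le> \<beta> * sum f {1..N}"
  using finite_atLeastAtMost[of 1 N] f0 mono
proof (induction f rule: layer_induct)
  case (zero f)
  then show ?case by simp
next
  case (layer f f' S \<delta>)
  define M where "M = card S"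
  have S: "S = {1..M}"
  proof (cases "S = {}")
    case False
    have "finite S" using layer.hyps(2) by simp
    define m where "m = Max S"
    have m: "m \<in> S" "\<And>x. x \<in> S \<Longrightarrow> x \<le> m"
      using False \<open>finite S\<close> by (auto simp: m_def)
    have "S = {1..m}"
    proof (intro equalityI subsetI)
      fix x assume "x \<in> {1..m}"
      then have "x \<in> {1..N}" "f m \<le> f x" "f m > 0"
        using m(1) layer.hyps(2) layer.prems by auto
      then show "x \<in> S" using layer.hyps(2) by simp
    next
      fix x assume "x \<in> S"
      then show "x \<in> {1..m}" using m(2) layer.hyps(2) by simp
    qed
    then show ?thesis by (simp add: M_def)
  qed (simp add: M_def)
  have "M \<le> card {1..N}" unfolding M_def layer.hyps(2) by (rule card_mono) auto
  then have "M \<le> N" by simp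
  \<comment> \<open>The induction hypothesis is only available for decreasing functions: on
    \<open>S\<close> both values drop by \<open>\<delta>\<close>, and outside \<open>S\<close> the
    remainder is 0.\<close>
  have f'mono: "\<forall>x\<in>{1..N}. \<forall>y\<in>{1..N}. x \<le> y \<longrightarrow> f' y \<le> f' x"
  proof (intro ballI impI)
    fix x y assume xy: "x \<in> {1..N}" "y \<in> {1..N}" "x \<le> y"
    show "f' y \<le> f' x"
    proof (cases "y \<in> S")
      case True
      then have "x \<in> S" using S xy by auto
      with True show ?thesis
        using layer.hyps(3)[OF xy(1)] layer.hyps(3)[OF xy(2)] layer.prems xy by force
    next
      case False
      then show ?thesis using layer.hyps(4)[OF xy(1)] layer.hyps(5)[of y] xy by simp
    qed
  qed
  have "max 0 (f x - f y) = max 0 (f' x - f' y) + \<delta> * of_bool (x \<in> S \<and> y \<notin> S)"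
    if "x \<in> {1..N}" "y \<in> {1..N}" for x y
    using that layer.hyps(1,3,4,5) max_diff_layer[of \<delta> f' x y S] by auto
  then have "(\<Sum>x\<in>{1..N}. \<Sum>y\<in>{1..N}. K x y * max 0 (f x - f y)) =
    (\<Sum>x\<in>{1..N}. \<Sum>y\<in>{1..N}. K x y * max 0 (f' x - f' y)
                             + \<delta> * (K x y * of_bool (x \<in> S \<and> y \<notin> S)))"
    by (intro sum.cong refl) (simp add: algebra_simps)
  also have "\<dots> = (\<Sum>x\<in>{1..N}. \<Sum>y\<in>{1..N}. K x y * max 0 (f' x - f' y)) +
      \<delta> * (\<Sum>x\<in>{1..N}. \<Sum>y\<in>{1..N}. K x y * of_bool (x \<in> S \<and> y \<notin> S))"
    by (simp add: sum.distrib flip: sum_distrib_left)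
  also have "(\<Sum>x\<in>{1..N}. \<Sum>y\<in>{1..N}. K x y * of_bool (x \<in> S \<and> y \<notin> S)) =
             (\<Sum>x\<in>{1..M}. \<Sum>y\<in>{1..N}. K x y * of_bool (x \<in> S \<and> y \<notin> S))"
    using \<open>M \<le> N\<close> S by (intro sum.mono_neutral_right) auto
  also have "\<dots> = (\<Sum>x\<in>{1..M}. \<Sum>y\<in>{M<..N}. K x y)"
    using \<open>M \<le> N\<close> S by (intro sum.cong refl sum.mono_neutral_cong_right) auto
  also have "(\<Sum>x\<in>{1..N}. \<Sum>y\<in>{1..N}. K x y * max 0 (f' x - f' y)) +
      \<delta> * (\<Sum>x\<in>{1..M}. \<Sum>y\<in>{M<..N}. K x y) \<le> \<beta> * sum f' {1..N} + \<delta> * (\<beta> * M)"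
    using layer.IH[OF f'mono] step[OF \<open>M \<le> N\<close>] layer.hyps(1)
    by (intro add_mono mult_left_mono) auto
  also have "\<dots> = \<beta> * sum f {1..N}"
  proof -
    have "sum f {1..N} = sum f' {1..N} + \<delta> * (\<Sum>x\<in>{1..N}. of_bool (x \<in> S))"
      unfolding sum_distrib_left sum.distrib[symmetric]
      by (intro sum.cong refl layer.hyps(3))
    also have "(\<Sum>x\<in>{1..N}. of_bool (x \<in> S)) = (\<Sum>x\<in>{1..M}. 1 :: real)"
      using \<open>M \<le> N\<close> S by (intro sum.mono_neutral_cong_right) auto
    finally show ?thesis by (simp add: algebra_simps)
  qed
  finally show ?case .
qed

section \<open>Random partners\<close>

definition window :: "nat \<Rightarrow> nat \<Rightarrow> nat \<Rightarrow> nat set" where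
  "window b t x = {x - x div 2 ^ t..x + x div 2 ^ b}"

definition partner :: "nat \<Rightarrow> nat \<Rightarrow> nat pmf" where
  "partner b x = bind_pmf (pmf_of_set {..b}) (\<lambda>t. pmf_of_set (window b t x))"

lemma finite_window [simp]: "finite (window b t x)"
  and window_nonempty [simp]: "window b t x \<noteq> {}"
  by (auto simp: window_def)

text \<open>As \<open>t \<le> b\<close>, both arms of the window have length at most
  \<open>w\<close>; the centre is absorbed by \<open>1 \<le> w\<close>.\<close>

lemma card_window_le:
  assumes "t \<le> b" "x \<le> z" "z div 2 ^ t \<le> w" "w > 0"
  shows "card (window b t x) \<le> 3 * w"
proof -
  have "x div 2 ^ b \<le> x div 2 ^ t"
    using assms(1) by (intro div_le_mono2) (auto intro: power_increasing)
  also have "x div 2 ^ t \<le> z div 2 ^ t" using assms(2) by (rule div_le_mono)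
  finally have "x div 2 ^ b \<le> w" "x div 2 ^ t \<le> w"
    using assms(3) \<open>x div 2 ^ t \<le> z div 2 ^ t\<close> by linarith+
  moreover have "x div 2 ^ t \<le> x" by (rule div_le_dividend)
  ultimately show ?thesis using assms(4) by (simp add: window_def)
qed

lemma pmf_partner:
  "pmf (partner b x) y = (\<Sum>t\<le>b. of_bool (y \<in> window b t x) / card (window b t x)) / (real b + 1)"
  unfolding partner_def
  by (subst pmf_bind_pmf_of_set) (auto simp: indicator_def of_bool_def add_ac)

text \<open>Only scale \<open>t\<close> is kept, which is drawn with probability
  \<open>1 / (b + 1)\<close>. The point \<open>z\<close> provides one bound \<open>w\<close> for all
  \<open>x \<le> z\<close>.\<close>

lemma pmf_partner_ge:
  fixes w :: nat
  assumes "t \<le> b" "y \<in> window b t x" "x \<le> z" "z div 2 ^ t \<le> w" "w > 0"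
  shows "pmf (partner b x) y \<ge> 1 / (3 * real w * (real b + 1))"
proof -
  have "1 / (3 * real w) \<le> 1 / card (window b t x)"
    using card_window_le[OF assms(1,3,4,5)] card_gt_0_iff[of "window b t x"]
    by (intro divide_left_mono) auto
  also have "\<dots> = of_bool (y \<in> window b t x) / card (window b t x)"
    using assms by simp
  also have "\<dots> \<le> (\<Sum>t\<le>b. of_bool (y \<in> window b t x) / card (window b t x))"
    using assms(1) by (intro member_le_sum) auto
  finally have "1 / (3 * real w) / (real b + 1) \<le> pmf (partner b x) y"
    unfolding pmf_partner by (intro divide_right_mono) auto
  then show ?thesis by (simp add: field_simps)
qed

text \<open>The left end of a window moves right with its centre, since raising \<open>x\<close> by
  some amount raises \<open>x div k\<close> by at most that amount.\<close>

lemma diff_div_mono: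
  fixes x y k :: nat
  assumes "x \<le> y"
  shows "x - x div k \<le> y - y div k"
proof (cases "k = 0")
  case False
  have "y div k \<le> x div k + (y - x)"
  proof -
    have "y \<le> x + k * (y - x)" using assms False
      using mult_le_mono1[of 1 k "y - x"] by linarith
    then have "y div k \<le> (x + k * (y - x)) div k" by (rule div_le_mono)
    then show ?thesis using False by simp
  qed
  moreover have "x div k \<le> x" by simp
  ultimately show ?thesis using assms by linarith
qed (use assms in simp)

text \<open>Every \<open>y\<close> in \<open>Y\<close> is either below the threshold and seen from \<open>j\<close>, or above it
  and sees \<open>i\<close>.\<close>

lemma pair_violation_from_window:
  fixes K :: "'a \<Rightarrow> 'a \<Rightarrow> real"
  assumes "finite X" "Y \<subseteq> X" and K: "\<And>x y. K x y \<ge> 0"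
    and "i \<notin> S"
    and "\<And>y. y \<in> Y \<Longrightarrow> K j y \<ge> c" "\<And>y. \<lbrakk>y \<in> Y; y \<noteq> i\<rbrakk> \<Longrightarrow> K y i \<ge> c"
  shows "c * card Y \<le> (\<Sum>y\<in>X. K j y * of_bool (y \<notin> S)) + (\<Sum>y\<in>X. K y i * of_bool (y \<in> S))"
proof -
  have "c * card Y = (\<Sum>y\<in>Y. c)" by simp
  also have "\<dots> \<le> (\<Sum>y\<in>Y. K j y * of_bool (y \<notin> S) + K y i * of_bool (y \<in> S))"
    using assms(4-6) by (intro sum_mono) auto
  also have "\<dots> \<le> (\<Sum>y\<in>X. K j y * of_bool (y \<notin> S) + K y i * of_bool (y \<in> S))"
    using assms(1,2) K by (intro sum_mono2) auto
  finally show ?thesis by (simp add: sum.distrib)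
qed

lemma partner_pair_violation:
  assumes ij: "i \<in> {1..N}" "j \<in> {1..N}" "i < j" and "i \<notin> S" and "b > 0"
  shows "1 / (6 * (real b + 1)) \<le> (\<Sum>y\<in>{1..N}. pmf (partner b j) y * of_bool (y \<notin> S)) +
                            (\<Sum>y\<in>{1..N}. pmf (partner b y) i * of_bool (y \<in> S))"
proof -
  define l where "l = j - i"
  have l: "l > 0" "l \<le> j" using ij by (auto simp: l_def)
  \<comment> \<open>The aim is a set \<open>Y\<close> filling at least half of a length
    \<open>w\<close>, all of whose points are seen from \<open>j\<close> and see \<open>i\<close>
    with density \<open>1 / (3 * w * (b + 1))\<close>. Half of a third gives the constant
    1/6.\<close>
  have "\<exists>Y w. Y \<subseteq> {1..N} \<and> w \<le> 2 * card Y \<and> w > 0 \<and>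
     (\<forall>y\<in>Y. pmf (partner b j) y \<ge> 1 / (3 * real w * (real b + 1))) \<and>
     (\<forall>y\<in>Y - {i}. pmf (partner b y) i \<ge> 1 / (3 * real w * (real b + 1)))"
  proof (cases "l \<le> j div 2 ^ b")
    case True
    define w where "w = j div 2 ^ b"
    have "w > 0" using True l by (simp add: w_def)
    have "w * 2 ^ b \<le> j" unfolding w_def by (metis div_times_less_eq_dividend)
    have "2 * w \<le> w * 2 ^ b"
      using power_increasing[of 1 b "2::nat"] \<open>b > 0\<close> by simp
    \<comment> \<open>This keeps \<open>Y\<close> inside the positive numbers and is where
      \<open>b > 0\<close> enters.\<close>
    then have "2 * w \<le> j" using \<open>w * 2 ^ b \<le> j\<close> by linarith
    \<comment> \<open>Half of \<open>w\<close>, rounded up: \<open>w \<le> 2 * u\<close> makes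
      \<open>Y\<close> large enough, while \<open>2 * u \<le> w + 1\<close> together with the strict
      \<open>i < y + u\<close> lets the right window of \<open>y\<close> reach
      \<open>i\<close>.\<close>
    define u where "u = (w + 1) div 2"
    have u: "w \<le> 2 * u" "u \<le> w" "0 < u" "2 * u \<le> w + 1"
      using \<open>w > 0\<close> unfolding u_def by linarith+
    \<comment> \<open>\<open>Y\<close> is only half of the left window of \<open>j\<close>, so that the shorter right windows of its points
      still contain \<open>i\<close>.\<close>
    define Y where "Y = {j - u..<j}"
    have near: "i \<in> window b b y" if "y \<in> Y" for y
    proof (cases "i \<le> y")
      case True
      have "y - y div 2 ^ b \<le> j - j div 2 ^ b"
        using that by (intro diff_div_mono) (simp add: Y_def)
      also have "\<dots> \<le> i" using \<open>l \<le> j div 2 ^ b\<close> ij by (simp add: l_def)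
      finally show ?thesis using True by (simp add: window_def)
    next
      case False
      have "w \<le> y div 2 ^ b + u"
      proof -
        have "j \<le> y + u" using that by (auto simp: Y_def)
        moreover have "u * 1 \<le> u * 2 ^ b" by (intro mult_le_mono) auto
        ultimately have "j \<le> y + u * 2 ^ b" by linarith
        then have "j div 2 ^ b \<le> (y + u * 2 ^ b) div 2 ^ b" by (rule div_le_mono)
        then show ?thesis by (simp add: w_def)
      qed
      moreover have "i < y + u" using that ij by (auto simp: Y_def)
      ultimately have "i \<le> y + y div 2 ^ b" using u by linarith
      then show ?thesis using False by (simp add: window_def)
    qed
    show ?thesis
    proof (intro exI conjI ballI)
      show "Y \<subseteq> {1..N}" using ij u \<open>2 * w \<le> j\<close> by (auto simp: Y_def)
      show "w \<le> 2 * card Y" "0 < w"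
        using u \<open>2 * w \<le> j\<close> \<open>w > 0\<close> by (auto simp: Y_def)
      show "pmf (partner b j) y \<ge> 1 / (3 * real w * (real b + 1))" if "y \<in> Y" for y
        by (rule pmf_partner_ge[where t = b and z = j])
          (use that u \<open>w > 0\<close> in \<open>auto simp: window_def Y_def w_def\<close>)
      show "pmf (partner b y) i \<ge> 1 / (3 * real w * (real b + 1))" if "y \<in> Y - {i}" for y
        by (rule pmf_partner_ge[where t = b and z = j])
          (use that near \<open>w > 0\<close> in \<open>auto simp: Y_def w_def\<close>)
    qed
  next
    case False
    \<comment> \<open>The finest scale at which the left window of \<open>j\<close> still reaches
      \<open>i\<close>; scale 0 always does. By maximality the next scale falls short, so the reach
      at scale \<open>t\<close> is at most \<open>2 * l\<close>.\<close>
    define t where "t = (GREATEST t. t \<le> b \<and> l \<le> j div 2 ^ t)"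
    have t: "t \<le> b \<and> l \<le> j div 2 ^ t"
      unfolding t_def by (rule GreatestI_nat[where k = 0 and b = b]) (use l in auto)
    have tmax: "s \<le> t" if "s \<le> b" "l \<le> j div 2 ^ s" for s
      unfolding t_def by (rule Greatest_le_nat[where b = b]) (use that in auto)
    have "t \<noteq> b" using False t by auto
    then have "j div 2 ^ Suc t < l" using tmax[of "Suc t"] t by (meson Suc_leI Suc_n_not_le_n le_neq_implies_less not_le_imp_less)
    moreover have "j div 2 ^ Suc t = j div 2 ^ t div 2"
      by (metis div_mult2_eq mult.commute power_Suc)
    ultimately have w: "j div 2 ^ t \<le> 2 * l" by linarith
    define Y where "Y = {i..<j}"
    have sub: "y - y div 2 ^ t \<le> i" if "y \<le> j" for y
    proof -
      have "y - y div 2 ^ t \<le> j - j div 2 ^ t" by (rule diff_div_mono[OF that])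
      also have "\<dots> \<le> i" using t ij unfolding l_def by linarith
      finally show ?thesis .
    qed
    show ?thesis
    proof (intro exI conjI ballI)
      show "Y \<subseteq> {1..N}" using ij by (auto simp: Y_def)
      show "2 * l \<le> 2 * card Y" "0 < 2 * l"
        using l by (auto simp: Y_def l_def)
      show "pmf (partner b j) y \<ge> 1 / (3 * real (2 * l) * (real b + 1))" if "y \<in> Y" for y
        using pmf_partner_ge[of t b y j j "2 * l"] that sub[of j] t w l
        by (auto simp: window_def Y_def)
      show "pmf (partner b y) i \<ge> 1 / (3 * real (2 * l) * (real b + 1))" if "y \<in> Y - {i}" for y
        using pmf_partner_ge[of t b i y j "2 * l"] that sub[of y] t w l
        by (auto simp: window_def Y_def)
    qed
  qed
  then obtain Y w where Y: "Y \<subseteq> {1..N}" "w \<le> 2 * card Y" "w > 0"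
     "\<forall>y\<in>Y. pmf (partner b j) y \<ge> 1 / (3 * real w * (real b + 1))"
     "\<forall>y\<in>Y - {i}. pmf (partner b y) i \<ge> 1 / (3 * real w * (real b + 1))" by blast
  have "1 / (6 * (real b + 1)) = 1 / (3 * real w * (real b + 1)) * (w / 2)"
    using Y(3) by simp
  also have "\<dots> \<le> 1 / (3 * real w * (real b + 1)) * card Y"
    using Y(2) by (intro mult_left_mono) auto
  also have "\<dots> \<le> (\<Sum>y\<in>{1..N}. pmf (partner b j) y * of_bool (y \<notin> S)) +
                   (\<Sum>y\<in>{1..N}. pmf (partner b y) i * of_bool (y \<in> S))"
    using Y \<open>i \<notin> S\<close> by (intro pair_violation_from_window) auto
  finally show ?thesis by simp
qed

text \<open>At every scale the right reach is only \<open>x div 2 ^ b\<close>. Hence only the last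
  \<open>M div 2 ^ b\<close> points of \<open>{1..M}\<close> can leave the segment, each with mass
  at most 1.\<close>

lemma partner_escape_mass_le:
  "(\<Sum>x\<in>{1..M}. \<Sum>y\<in>{M<..N}. pmf (partner b x) y) \<le> 1 / 2 ^ b * M"
proof -
  define A where "A = {x \<in> {1..M}. x + x div 2 ^ b > M}"
  have supp: "set_pmf (partner b x) \<subseteq> {..x + x div 2 ^ b}" for x
    by (auto simp: partner_def window_def set_pmf_of_set)
  have "(\<Sum>y\<in>{M<..N}. pmf (partner b x) y) \<le> of_bool (x \<in> A)" if "x \<in> {1..M}" for x
  proof (cases "x \<in> A")
    case True
    have "(\<Sum>y\<in>{M<..N}. pmf (partner b x) y) = measure_pmf.prob (partner b x) {M<..N}"
      by (simp add: measure_measure_pmf_finite)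
    then show ?thesis using True by simp
  next
    case False
    then have "pmf (partner b x) y = 0" if "y > M" for y
      using supp[of x] \<open>x \<in> {1..M}\<close> that by (force simp: A_def set_pmf_iff)
    then show ?thesis by (simp add: sum_nonneg)
  qed
  then have "(\<Sum>x\<in>{1..M}. \<Sum>y\<in>{M<..N}. pmf (partner b x) y) \<le> (\<Sum>x\<in>{1..M}. of_bool (x \<in> A))"
    by (rule sum_mono)
  also have "\<dots> = card A" by (simp add: A_def Int_def)
  also have "card A \<le> card {M - M div 2 ^ b<..M}"
  proof (rule card_mono)
    show "A \<subseteq> {M - M div 2 ^ b<..M}"
    proof
      fix x assume "x \<in> A"
      then have "x > 0" "x \<le> M" "x + x div 2 ^ b > M" by (auto simp: A_def)
      moreover have "x div 2 ^ b \<le> M div 2 ^ b" using \<open>x \<le> M\<close> by (rule div_le_mono)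
      ultimately show "x \<in> {M - M div 2 ^ b<..M}"
        unfolding greaterThanAtMost_iff by linarith
    qed
  qed simp
  also have "\<dots> \<le> M div 2 ^ b" by simp
  also have "real (M div 2 ^ b) \<le> M / 2 ^ b"
    using of_nat_div_le_of_nat[of M "2 ^ b"] by simp
  finally show ?thesis by simp
qed

section \<open>The tester\<close>

text \<open>Written with a continuation \<open>k\<close>, because a decision tree returns nothing
  but a verdict; \<open>c\<close> counts the answers equal to \<open>y\<close> so far.\<close>

primrec tally :: "nat \<Rightarrow> nat \<Rightarrow> nat \<Rightarrow> nat \<Rightarrow> (nat \<Rightarrow> query_alg) \<Rightarrow> query_alg" where
  "tally x y 0 c k = k c"
| "tally x y (Suc m) c k = Query {x, y} (\<lambda>z. tally x y m (if z = y then Suc c else c) k)"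

text \<open>A window may contain 0 or points beyond \<open>N\<close>; a partner outside the domain,
  or equal to \<open>x\<close>, counts as a passed trial.\<close>

primrec trials :: "nat \<Rightarrow> nat \<Rightarrow> nat \<Rightarrow> real \<Rightarrow> nat \<Rightarrow> query_alg" where
  "trials N b m \<tau> 0 = Output ACCEPT"
| "trials N b m \<tau> (Suc R) = Query {1..N} (\<lambda>x. Random (partner b x) (\<lambda>y.
     if y \<in> {1..N} \<and> y \<noteq> x
     then tally x y m 0 (\<lambda>c. if real c < \<tau> * m then Output REJECT else trials N b m \<tau> R)
     else trials N b m \<tau> R))"

section \<open>Worst-case number of queries\<close>

lemma queries_at_most_mono:
  "\<lbrakk>queries_at_most N A q; q \<le> q'\<rbrakk> \<Longrightarrow> queries_at_most N A q'"
proof (induction A arbitrary: q q')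
  case (Query S k)
  then show ?case
    by (auto intro: Query.IH[OF rangeI] diff_le_mono)
next
  case (Random p k)
  then show ?case by (auto intro: Random.IH[OF rangeI])
qed simp

lemma queries_at_most_tally:
  assumes "x \<in> {1..N}" "y \<in> {1..N}" "\<And>c. queries_at_most N (k c) q"
  shows "queries_at_most N (tally x y m c k) (m + q)"
  using assms by (induction m arbitrary: c) auto

lemma queries_at_most_trials:
  assumes "N \<ge> 1"
  shows "queries_at_most N (trials N b m \<tau> R) (R * (m + 1))"
proof (induction R)
  case (Suc R)
  have rest: "queries_at_most N (if y \<in> {1..N} \<and> y \<noteq> x
     then tally x y m 0 (\<lambda>c. if real c < \<tau> * m then Output REJECT else trials N b m \<tau> R)
     else trials N b m \<tau> R) (m + R * (m + 1))" if "x \<in> {1..N}" for x y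
  proof (cases "y \<in> {1..N} \<and> y \<noteq> x")
    case True
    have "queries_at_most N (if real c < \<tau> * m then Output REJECT else trials N b m \<tau> R)
            (R * (m + 1))" for c
      using Suc.IH by simp
    then show ?thesis
      using True that by (simp only: if_True queries_at_most_tally simp_thms)
  next
    case False
    show ?thesis
      unfolding if_not_P[OF False] by (rule queries_at_most_mono[OF Suc.IH]) simp
  qed
  have "Suc R * (m + 1) - 1 = m + R * (m + 1)" by simp
  then show ?case
    using assms rest by (simp only: trials.simps queries_at_most.simps) auto
qed simp

section \<open>Output distribution as that of independent trials\<close>

lemma bernoulli_pmf_eq_map:
  "bernoulli_pmf (pmf p y) = map_pmf (\<lambda>z. z = y) p"
proof (rule pmf_eqI)
  fix b
  have "measure_pmf.prob p {z. z \<noteq> y} = 1 - pmf p y"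
    using measure_pmf.prob_compl[of "{y}" p]
    by (simp add: measure_pmf_single Compl_eq_Diff_UNIV[symmetric] Collect_neg_eq)
  then show "pmf (bernoulli_pmf (pmf p y)) b = pmf (map_pmf (\<lambda>z. z = y) p) b"
    by (cases b) (simp_all add: pmf_le_1 pmf_map vimage_def measure_pmf_single)
qed

text \<open>Repeated queries to the same set are answered independently, so the number of answers
  \<open>y\<close> is binomial, whatever the oracle.\<close>

lemma run_tally:
  "run orc (tally x y m c k) =
     bind_pmf (binomial_pmf m (pmf (orc {x, y}) y)) (\<lambda>n. run orc (k (c + n)))"
proof (induction m arbitrary: c)
  case 0
  then show ?case by (simp add: binomial_pmf_0 pmf_le_1 bind_return_pmf)
next
  case (Suc m)
  have "run orc (tally x y (Suc m) c k) =
     bind_pmf (map_pmf (\<lambda>z. z = y) (orc {x, y})) (\<lambda>e. bind_pmf (binomial_pmf m (pmf (orc {x, y}) y))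
       (\<lambda>n. run orc (k (c + (of_bool e + n)))))"
    by (auto simp: Suc.IH bind_map_pmf intro!: bind_pmf_cong)
  also have "\<dots> = bind_pmf (binomial_pmf (Suc m) (pmf (orc {x, y}) y)) (\<lambda>n. run orc (k (c + n)))"
    by (subst binomial_pmf_Suc)
      (auto simp: pmf_le_1 bernoulli_pmf_eq_map bind_assoc_pmf bind_return_pmf of_bool_def
            intro!: bind_pmf_cong)
  finally show ?case .
qed

text \<open>One round described without the oracle; \<open>True\<close> means that the round
  rejects.\<close>

definition trial :: "nat \<Rightarrow> nat pmf \<Rightarrow> nat \<Rightarrow> nat \<Rightarrow> real \<Rightarrow> bool pmf" where
  "trial N D b m \<tau> = bind_pmf D (\<lambda>x. bind_pmf (partner b x) (\<lambda>y.
     if y \<in> {1..N} \<and> y \<noteq> x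
     then map_pmf (\<lambda>c. real c < \<tau> * m) (binomial_pmf m (pmf D y / (pmf D x + pmf D y)))
     else return_pmf False))"

lemma cond_oracleD:
  assumes "cond_oracle N D orc" "S \<subseteq> {1..N}" "S \<noteq> {}"
  shows "set_pmf (orc S) \<subseteq> S"
    and "\<lbrakk>measure_pmf.prob D S > 0; i \<in> S\<rbrakk> \<Longrightarrow> pmf (orc S) i = pmf D i / measure_pmf.prob D S"
  using assms unfolding cond_oracle_def by blast+

text \<open>Conditioning on an event of probability 1 is plain sampling from
  \<open>D\<close>.\<close>

lemma cond_oracle_full:
  assumes "cond_oracle N D orc" "D \<in> distributions N" "N \<ge> 1"
  shows "orc {1..N} = D"
proof (rule pmf_eqI)
  fix i
  have sub: "set_pmf D \<subseteq> {1..N}" using assms by (simp add: distributions_def)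
  then have "measure_pmf.prob D {1..N} = 1"
    by (subst measure_pmf.prob_eq_1) (auto simp: AE_measure_pmf_iff)
  then have "pmf (orc {1..N}) i = pmf D i" if "i \<in> {1..N}"
    using cond_oracleD(2)[OF assms(1) order.refl, of i] that by simp
  moreover have "set_pmf (orc {1..N}) \<subseteq> {1..N}"
    using cond_oracleD(1)[OF assms(1) order.refl] assms(3) by simp
  ultimately show "pmf (orc {1..N}) i = pmf D i"
    using sub by (metis pmf_eq_0_set_pmf subsetD)
qed

text \<open>A sampled \<open>x\<close> has positive mass, so the pair does too, and the unspecified
  answers on null sets never occur.\<close>

lemma cond_oracle_pair:
  assumes "cond_oracle N D orc" "x \<in> {1..N}" "y \<in> {1..N}" "x \<noteq> y" "x \<in> set_pmf D"
  shows "pmf (orc {x, y}) y = pmf D y / (pmf D x + pmf D y)"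
proof -
  have prob: "measure_pmf.prob D {x, y} = pmf D x + pmf D y"
    using assms(4) by (simp add: measure_measure_pmf_finite)
  moreover have "pmf D x > 0" using assms(5) by (rule pmf_positive)
  ultimately have "measure_pmf.prob D {x, y} > 0" by (simp add: add_pos_nonneg)
  then show ?thesis using cond_oracleD(2)[OF assms(1), of "{x, y}" y] assms prob by simp
qed

lemma run_trials_Suc:
  assumes "cond_oracle N D orc" "D \<in> distributions N" "N \<ge> 1"
  shows "run orc (trials N b m \<tau> (Suc R)) =
    bind_pmf (trial N D b m \<tau>) (\<lambda>r. if r then return_pmf REJECT else run orc (trials N b m \<tau> R))"
proof -
  let ?rest = "run orc (trials N b m \<tau> R)"
  let ?out = "\<lambda>r. if r then return_pmf REJECT else ?rest"
  have full: "orc {1..N} = D" by (rule cond_oracle_full[OF assms])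
  have "run orc (if y \<in> {1..N} \<and> y \<noteq> x
     then tally x y m 0 (\<lambda>c. if real c < \<tau> * m then Output REJECT else trials N b m \<tau> R)
     else trials N b m \<tau> R) =
     bind_pmf (if y \<in> {1..N} \<and> y \<noteq> x
       then map_pmf (\<lambda>c. real c < \<tau> * m) (binomial_pmf m (pmf D y / (pmf D x + pmf D y)))
       else return_pmf False) ?out" if "x \<in> set_pmf D" for x y
  proof (cases "y \<in> {1..N} \<and> y \<noteq> x")
    case True
    have "x \<in> {1..N}" using assms that by (auto simp: distributions_def)
    then have p: "pmf (orc {x, y}) y = pmf D y / (pmf D x + pmf D y)"
      using True that by (intro cond_oracle_pair[OF assms(1)]) auto
    show ?thesis
      unfolding if_P[OF True] run_tally p bind_map_pmf by (intro bind_pmf_cong) auto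
  next
    case False
    show ?thesis unfolding if_not_P[OF False] bind_return_pmf by simp
  qed
  then show ?thesis
    unfolding trial_def bind_assoc_pmf trials.simps run.simps full
    by (intro bind_pmf_cong refl)
qed

lemma pmf_run_trials_ACCEPT:
  assumes "cond_oracle N D orc" "D \<in> distributions N" "N \<ge> 1"
  shows "pmf (run orc (trials N b m \<tau> R)) ACCEPT = (1 - pmf (trial N D b m \<tau>) True) ^ R"
proof (induction R)
  case (Suc R)
  have "pmf (trial N D b m \<tau>) False = 1 - pmf (trial N D b m \<tau>) True"
    using pmf_False_conv_True by blast
  then show ?case
    unfolding run_trials_Suc[OF assms] pmf_bind
    by (subst integral_measure_pmf_real[of UNIV]) (auto simp: UNIV_bool Suc.IH)
qed simp

lemma pmf_REJECT_conv_ACCEPT: "pmf p REJECT = 1 - pmf p ACCEPT"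
proof -
  have "(UNIV :: verdict set) = {ACCEPT, REJECT}" using verdict.exhaust by auto
  then have "measure_pmf.prob p {ACCEPT, REJECT} = 1"
    using measure_pmf.prob_space[of p] by simp
  then show ?thesis by (simp add: measure_measure_pmf_finite)
qed

section \<open>Reliability of a single comparison\<close>

definition rejection :: "nat \<Rightarrow> real \<Rightarrow> real \<Rightarrow> real" where
  "rejection m \<tau> p = measure_pmf.prob (binomial_pmf m p) {c. real c < \<tau> * m}"

lemma pmf_trial_True:
  assumes "D \<in> distributions N"
  shows "pmf (trial N D b m \<tau>) True =
    (\<Sum>x\<in>{1..N}. \<Sum>y\<in>{1..N}. pmf (partner b x) y *
        (pmf D x * (of_bool (y \<noteq> x) * rejection m \<tau> (pmf D y / (pmf D x + pmf D y)))))"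
proof -
  have sub: "set_pmf D \<subseteq> {1..N}" using assms by (simp add: distributions_def)
  have inner: "measure_pmf.expectation (partner b x) (\<lambda>y. pmf (if y \<in> {1..N} \<and> y \<noteq> x
     then map_pmf (\<lambda>c. real c < \<tau> * m) (binomial_pmf m (pmf D y / (pmf D x + pmf D y)))
     else return_pmf False) True) =
     (\<Sum>y\<in>{1..N}. pmf (partner b x) y *
        (of_bool (y \<noteq> x) * rejection m \<tau> (pmf D y / (pmf D x + pmf D y))))" for x
    \<comment> \<open>Partners outside the domain never reject, so the expectation reduces to a sum
      over \<open>{1..N}\<close>.\<close>
    by (subst integral_measure_pmf_real[of "{1..N}"])
      (auto simp: rejection_def pmf_map vimage_def mult_ac intro!: sum.cong split: if_splits)
  show ?thesis
    unfolding trial_def pmf_bind inner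
    by (subst integral_measure_pmf_real[of "{1..N}"]) (use sub in \<open>auto simp: sum_distrib_left mult_ac\<close>)
qed

text \<open>The rejection threshold lies midway between the two values of \<open>p\<close> to be told apart.\<close>

lemma rejection_le:
  assumes "p \<in> {0..1}" "\<eta> > 0" "m > 0" "p \<ge> 1/2 - \<eta>/8"
  shows "rejection m (1/2 - 3*\<eta>/16) p \<le> exp (- (m * \<eta>\<^sup>2 / 128))"
proof -
  interpret binomial_distribution m p by unfold_locales (fact assms(1))
  have "rejection m (1/2 - 3*\<eta>/16) p \<le>
        measure_pmf.prob (binomial_pmf m p) {x. real x \<le> m * p - m * \<eta> / 16}"
    unfolding rejection_def
  proof (intro measure_pmf.finite_measure_mono subsetI CollectI)
    fix c :: nat assume "c \<in> {c. real c < (1/2 - 3*\<eta>/16) * m}"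
    then have "real c \<le> m * (1/2 - \<eta>/8) - m * \<eta> / 16" by (simp add: algebra_simps)
    also have "m * (1/2 - \<eta>/8) \<le> m * p" using assms by (intro mult_left_mono) auto
    finally show "real c \<le> m * p - m * \<eta> / 16" by simp
  qed simp
  \<comment> \<open>Hoeffding's inequality; the threshold is \<open>\<eta>/16\<close> below
    \<open>1/2 - \<eta>/8\<close>.\<close>
  also have "\<dots> \<le> exp (-2 * (m * \<eta> / 16)\<^sup>2 / m)"
    using assms by (intro prob_le) auto
  also have "-2 * (m * \<eta> / 16)\<^sup>2 / m = - (m * \<eta>\<^sup>2 / 128)"
    using assms by (simp add: power2_eq_square field_simps)
  finally show ?thesis .
qed

lemma rejection_ge:
  assumes "p \<in> {0..1}" "\<eta> > 0" "m > 0" "p \<le> 1/2 - \<eta>/4"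
  shows "rejection m (1/2 - 3*\<eta>/16) p \<ge> 1 - exp (- (m * \<eta>\<^sup>2 / 128))"
proof -
  interpret binomial_distribution m p by unfold_locales (fact assms(1))
  have "measure_pmf.prob (binomial_pmf m p) {c. \<not> real c < (1/2 - 3*\<eta>/16) * m} \<le>
        measure_pmf.prob (binomial_pmf m p) {x. real x \<ge> m * p + m * \<eta> / 16}"
  proof (intro measure_pmf.finite_measure_mono subsetI CollectI)
    fix c :: nat assume "c \<in> {c. \<not> real c < (1/2 - 3*\<eta>/16) * m}"
    then have "real c \<ge> m * (1/2 - \<eta>/4) + m * \<eta> / 16" by (simp add: algebra_simps)
    moreover have "m * (1/2 - \<eta>/4) \<ge> m * p" using assms by (intro mult_left_mono) auto
    ultimately show "real c \<ge> m * p + m * \<eta> / 16" by simp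
  qed simp
  also have "\<dots> \<le> exp (-2 * (m * \<eta> / 16)\<^sup>2 / m)"
    using assms by (intro prob_ge) auto
  also have "-2 * (m * \<eta> / 16)\<^sup>2 / m = - (m * \<eta>\<^sup>2 / 128)"
    using assms by (simp add: power2_eq_square field_simps)
  finally show ?thesis
    unfolding rejection_def
    using measure_pmf.prob_neg[of "binomial_pmf m p" "\<lambda>c. real c < (1/2 - 3*\<eta>/16) * m"] by simp
qed

section \<open>Acceptance and rejection probabilities\<close>

definition violation :: "nat \<Rightarrow> nat \<Rightarrow> nat pmf \<Rightarrow> real" where
  "violation N b D =
     (\<Sum>x\<in>{1..N}. \<Sum>y\<in>{1..N}. pmf (partner b x) y * max 0 (pmf D x - pmf D y))"

lemma sum_pmf_distribution: "D \<in> distributions N \<Longrightarrow> (\<Sum>x\<in>{1..N}. pmf D x) = 1"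
  by (rule sum_pmf_eq_1) (auto simp: distributions_def)

lemma rejection_nonneg: "rejection m \<tau> p \<ge> 0" and rejection_le_1: "rejection m \<tau> p \<le> 1"
  by (simp_all add: rejection_def)

text \<open>If \<open>v\<close> is at least \<open>(1 - \<eta>/4) * u\<close>, the comparison is on
  the safe side of the threshold and rarely rejects. Otherwise \<open>u - v\<close> exceeds
  \<open>\<eta>/4 * u\<close>, and bounding the rejection probability by 1 suffices;
  \<open>u = 0\<close> is trivial.\<close>

lemma rejection_pair_le:
  fixes u v :: real
  assumes "u \<ge> 0" "v \<ge> 0" "0 < \<eta>" "\<eta> \<le> 1" "m > 0"
  shows "u * rejection m (1/2 - 3*\<eta>/16) (v / (u + v)) \<le>
           exp (- (m * \<eta>\<^sup>2 / 128)) * u + 4 / \<eta> * max 0 (u - v)"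
proof (cases "u > 0 \<and> v \<ge> (1 - \<eta>/4) * u")
  case True
  have "(1/2 - \<eta>/8) * u \<le> (1 - \<eta>/4) * u * (1/2 + \<eta>/8)"
  proof -
    have "\<eta> * \<eta> \<le> \<eta> * 1" using assms by (intro mult_left_mono) auto
    then have "1/2 - \<eta>/8 \<le> (1 - \<eta>/4) * (1/2 + \<eta>/8)" using assms by (simp add: algebra_simps)
    then have "(1/2 - \<eta>/8) * u \<le> ((1 - \<eta>/4) * (1/2 + \<eta>/8)) * u"
      using True by (intro mult_right_mono) auto
    then show ?thesis by (simp add: mult_ac)
  qed
  also have "\<dots> \<le> v * (1/2 + \<eta>/8)" using True assms by (intro mult_right_mono) auto
  finally have "(1/2 - \<eta>/8) * u \<le> v * (1/2 + \<eta>/8)" .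
  moreover have "(1/2 - \<eta>/8) * (u + v) - v = (1/2 - \<eta>/8) * u - v * (1/2 + \<eta>/8)"
    by (simp add: field_simps)
  ultimately have "(1/2 - \<eta>/8) * (u + v) \<le> v" by linarith
  then have "v / (u + v) \<ge> 1/2 - \<eta>/8" using True assms by (simp add: pos_le_divide_eq)
  then have "rejection m (1/2 - 3*\<eta>/16) (v / (u + v)) \<le> exp (- (m * \<eta>\<^sup>2 / 128))"
    using True assms by (intro rejection_le) auto
  then have "u * rejection m (1/2 - 3*\<eta>/16) (v / (u + v)) \<le> u * exp (- (m * \<eta>\<^sup>2 / 128))"
    using True by (intro mult_left_mono) auto
  moreover have "0 \<le> 4 / \<eta> * max 0 (u - v)" using assms by simp
  ultimately show ?thesis by (simp add: mult.commute)
next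
  case False
  have "u \<le> 4 / \<eta> * max 0 (u - v)"
  proof (cases "u > 0")
    case True
    then have "v < (1 - \<eta>/4) * u" using False by simp
    then have "\<eta>/4 * u \<le> u - v" by (simp add: algebra_simps)
    then have "\<eta>/4 * u \<le> max 0 (u - v)" by linarith
    then show ?thesis using assms by (simp add: field_simps)
  qed (use assms in simp)
  moreover have "u * rejection m (1/2 - 3*\<eta>/16) (v / (u + v)) \<le> u * 1"
    using assms by (intro mult_left_mono rejection_le_1) auto
  moreover have "0 \<le> exp (- (m * \<eta>\<^sup>2 / 128)) * u" using assms by simp
  ultimately show ?thesis by linarith
qed

text \<open>If \<open>v \<le> (1 - \<eta>) * u\<close> with \<open>u > 0\<close>, the comparison
  rejects almost surely up to the Hoeffding error. Otherwise the deficit is at most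
  \<open>\<eta> * u\<close> and the lower bound is not positive.\<close>

lemma rejection_pair_ge:
  fixes u v :: real
  assumes "u \<ge> 0" "v \<ge> 0" "0 < \<eta>" "\<eta> \<le> 1" "m > 0"
  shows "u * rejection m (1/2 - 3*\<eta>/16) (v / (u + v)) \<ge>
           (1 - exp (- (m * \<eta>\<^sup>2 / 128))) * (max 0 (u - v) - \<eta> * u)"
proof (cases "u > 0 \<and> v \<le> (1 - \<eta>) * u")
  case True
  have "v * (1/2 + \<eta>/4) \<le> (1 - \<eta>) * u * (1/2 + \<eta>/4)"
    using True assms by (intro mult_right_mono) auto
  also have "\<dots> \<le> (1/2 - \<eta>/4) * u"
  proof -
    have "1/2 - \<eta>/4 - (1 - \<eta>) * (1/2 + \<eta>/4) = \<eta>\<^sup>2 / 4"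
      by (simp add: field_simps power2_eq_square)
    then have "(1 - \<eta>) * (1/2 + \<eta>/4) \<le> 1/2 - \<eta>/4"
      using zero_le_power2[of \<eta>] by linarith
    then have "((1 - \<eta>) * (1/2 + \<eta>/4)) * u \<le> (1/2 - \<eta>/4) * u"
      using True by (intro mult_right_mono) auto
    then show ?thesis by (simp add: mult_ac)
  qed
  finally have "v * (1/2 + \<eta>/4) \<le> (1/2 - \<eta>/4) * u" .
  moreover have "v - (1/2 - \<eta>/4) * (u + v) = v * (1/2 + \<eta>/4) - (1/2 - \<eta>/4) * u"
    by (simp add: field_simps)
  ultimately have "v \<le> (1/2 - \<eta>/4) * (u + v)" by linarith
  then have "v / (u + v) \<le> 1/2 - \<eta>/4" using True assms by (simp add: pos_divide_le_eq)
  then have rej: "rejection m (1/2 - 3*\<eta>/16) (v / (u + v)) \<ge> 1 - exp (- (m * \<eta>\<^sup>2 / 128))"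
    using True assms by (intro rejection_ge) auto
  have "0 \<le> \<eta> * u" using assms by simp
  moreover have "max 0 (u - v) \<le> u" using assms by simp
  ultimately have "max 0 (u - v) - \<eta> * u \<le> u" by linarith
  then have "(1 - exp (- (m * \<eta>\<^sup>2 / 128))) * (max 0 (u - v) - \<eta> * u) \<le>
             (1 - exp (- (m * \<eta>\<^sup>2 / 128))) * u"
    by (intro mult_left_mono) auto
  also have "\<dots> \<le> rejection m (1/2 - 3*\<eta>/16) (v / (u + v)) * u"
    using rej True by (intro mult_right_mono) auto
  finally show ?thesis by (simp add: mult.commute)
next
  case False
  have "max 0 (u - v) - \<eta> * u \<le> 0"
    using False assms by (cases "u = 0") (auto simp: max_def algebra_simps)
  then have "(1 - exp (- (m * \<eta>\<^sup>2 / 128))) * (max 0 (u - v) - \<eta> * u) \<le> 0"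
    by (intro mult_nonneg_nonpos) auto
  also have "0 \<le> u * rejection m (1/2 - 3*\<eta>/16) (v / (u + v))"
    using assms rejection_nonneg by simp
  finally show ?thesis .
qed

text \<open>Only an inequality, because a partner may fall outside \<open>{1..N}\<close>.\<close>

lemma sum_partner_le_1: "(\<Sum>y\<in>{1..N}. pmf (partner b x) y) \<le> 1"
  using measure_pmf.prob_le_1[of "partner b x" "{1..N}"] by (simp add: measure_measure_pmf_finite)

lemma sum_joint_le_1:
  assumes "D \<in> distributions N"
  shows "(\<Sum>x\<in>{1..N}. \<Sum>y\<in>{1..N}. pmf (partner b x) y * pmf D x) \<le> 1"
proof -
  have "(\<Sum>x\<in>{1..N}. \<Sum>y\<in>{1..N}. pmf (partner b x) y * pmf D x) \<le> (\<Sum>x\<in>{1..N}. 1 * pmf D x)"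
    unfolding sum_distrib_right[symmetric]
    by (intro sum_mono mult_right_mono sum_partner_le_1) auto
  then show ?thesis using sum_pmf_distribution[OF assms] by simp
qed

lemma pmf_trial_True_le:
  assumes D: "D \<in> distributions N" and "0 < \<eta>" "\<eta> \<le> 1" "m > 0"
  shows "pmf (trial N D b m (1/2 - 3*\<eta>/16)) True \<le>
           exp (- (m * \<eta>\<^sup>2 / 128)) + 4 / \<eta> * violation N b D"
proof -
  let ?\<delta> = "exp (- (m * \<eta>\<^sup>2 / 128))"
  have "pmf D x * (of_bool (y \<noteq> x) * rejection m (1/2 - 3*\<eta>/16) (pmf D y / (pmf D x + pmf D y))) \<le>
      ?\<delta> * pmf D x + 4 / \<eta> * max 0 (pmf D x - pmf D y)" for x y
    using rejection_pair_le[of "pmf D x" "pmf D y" \<eta> m] assms(2-) by (cases "y = x") auto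
  then have "pmf (trial N D b m (1/2 - 3*\<eta>/16)) True \<le>
     (\<Sum>x\<in>{1..N}. \<Sum>y\<in>{1..N}. pmf (partner b x) y *
        (?\<delta> * pmf D x + 4 / \<eta> * max 0 (pmf D x - pmf D y)))"
    unfolding pmf_trial_True[OF D]
    by (intro sum_mono mult_left_mono) auto
  also have "\<dots> = ?\<delta> * (\<Sum>x\<in>{1..N}. \<Sum>y\<in>{1..N}. pmf (partner b x) y * pmf D x) +
                   4 / \<eta> * violation N b D"
    unfolding violation_def sum_distrib_left sum.distrib[symmetric]
    by (intro sum.cong refl) (simp add: algebra_simps)
  also have "\<dots> \<le> ?\<delta> * 1 + 4 / \<eta> * violation N b D"
    using sum_joint_le_1[OF D] by (intro add_right_mono mult_left_mono) auto
  finally show ?thesis by simp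
qed

lemma pmf_trial_True_ge:
  assumes D: "D \<in> distributions N" and "0 < \<eta>" "\<eta> \<le> 1" "m > 0"
  shows "pmf (trial N D b m (1/2 - 3*\<eta>/16)) True \<ge>
           (1 - exp (- (m * \<eta>\<^sup>2 / 128))) * (violation N b D - \<eta>)"
proof -
  let ?\<delta> = "exp (- (m * \<eta>\<^sup>2 / 128))"
  have pw: "(1 - ?\<delta>) * (max 0 (pmf D x - pmf D y) - \<eta> * pmf D x) \<le>
     pmf D x * (of_bool (y \<noteq> x) * rejection m (1/2 - 3*\<eta>/16) (pmf D y / (pmf D x + pmf D y)))" for x y
  proof (cases "y = x")
    case True
    have "(1 - ?\<delta>) * (- (\<eta> * pmf D x)) \<le> 0"
      using assms(2) by (intro mult_nonneg_nonpos) auto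
    then show ?thesis using True by simp
  next
    case False
    then show ?thesis using rejection_pair_ge[of "pmf D x" "pmf D y" \<eta> m] assms(2-) by auto
  qed
  have "violation N b D - \<eta> \<le> violation N b D -
          \<eta> * (\<Sum>x\<in>{1..N}. \<Sum>y\<in>{1..N}. pmf (partner b x) y * pmf D x)"
    using mult_left_mono[OF sum_joint_le_1[OF D, of b] less_imp_le[OF assms(2)]] by simp
  then have "(1 - ?\<delta>) * (violation N b D - \<eta>) \<le> (1 - ?\<delta>) * (violation N b D -
          \<eta> * (\<Sum>x\<in>{1..N}. \<Sum>y\<in>{1..N}. pmf (partner b x) y * pmf D x))"
    by (intro mult_left_mono) auto
  also have "\<dots> = (\<Sum>x\<in>{1..N}. \<Sum>y\<in>{1..N}. pmf (partner b x) y *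
     ((1 - ?\<delta>) * (max 0 (pmf D x - pmf D y) - \<eta> * pmf D x)))"
    unfolding violation_def sum_distrib_left sum_subtractf[symmetric]
    by (intro sum.cong refl) (simp add: algebra_simps)
  also have "\<dots> \<le> pmf (trial N D b m (1/2 - 3*\<eta>/16)) True"
    unfolding pmf_trial_True[OF D]
    by (intro sum_mono mult_left_mono pw) auto
  finally show ?thesis .
qed

section \<open>Violation of monotone and of far distributions\<close>

lemma violation_monotone_le:
  assumes "D \<in> monotone_distributions N"
  shows "violation N b D \<le> 1 / 2 ^ b"
proof -
  have "violation N b D \<le> 1 / 2 ^ b * sum (pmf D) {1..N}"
    unfolding violation_def
    by (rule antimono_violation_le)
      (use assms partner_escape_mass_le in \<open>auto simp: monotone_distributions_def\<close>)
  also have "sum (pmf D) {1..N} = 1"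
    using assms sum_pmf_distribution by (simp add: monotone_distributions_def)
  finally show ?thesis by simp
qed

text \<open>Normalising \<open>g\<close> moves it by \<open>\<bar>1 - s\<bar>\<close> in the L1
  norm, which is at most the distance already present. The distance thus at most doubles, and the
  factor 1/2 in \<open>dTV\<close> cancels this. A distance below 1 forces
  \<open>s > 0\<close>.\<close>

lemma ex_monotone_distribution_close:
  assumes D: "D \<in> distributions N" and g: "antimono g" "\<And>x. g x \<ge> 0"
    and close: "(\<Sum>x\<in>{1..N}. \<bar>pmf D x - g x\<bar>) < 1"
  shows "\<exists>D'\<in>monotone_distributions N. dTV N D D' \<le> (\<Sum>x\<in>{1..N}. \<bar>pmf D x - g x\<bar>)"
proof -
  define s where "s = sum g {1..N}"
  have "1 - s = (\<Sum>x\<in>{1..N}. pmf D x - g x)"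
    using sum_pmf_distribution[OF D] by (simp add: s_def sum_subtractf)
  then have s1: "\<bar>1 - s\<bar> \<le> (\<Sum>x\<in>{1..N}. \<bar>pmf D x - g x\<bar>)"
    using sum_abs[of "\<lambda>x. pmf D x - g x" "{1..N}"] by simp
  then have s: "s > 0" using close by linarith
  define p where "p x = (if x \<in> {1..N} then g x / s else 0)" for x
  have p0: "p x \<ge> 0" for x using s g(2) by (simp add: p_def)
  have "(\<integral>\<^sup>+x. ennreal (p x) \<partial>count_space UNIV) = (\<Sum>x\<in>{1..N}. ennreal (p x))"
    by (rule nn_integral_count_space') (auto simp: p_def)
  also have "\<dots> = ennreal (\<Sum>x\<in>{1..N}. p x)" using p0 by (simp add: sum_ennreal)
  also have "(\<Sum>x\<in>{1..N}. p x) = 1"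
    using s by (simp add: p_def s_def sum_divide_distrib[symmetric])
  finally have int: "(\<integral>\<^sup>+x. ennreal (p x) \<partial>count_space UNIV) = 1" by simp
  define D' where "D' = embed_pmf p"
  have D': "pmf D' x = p x" for x
    unfolding D'_def by (rule pmf_embed_pmf[OF p0 int])
  have "D' \<in> monotone_distributions N"
    using g(1) s unfolding monotone_distributions_def distributions_def
    by (auto simp: D' set_pmf_iff p_def divide_right_mono antimonoD split: if_splits)
  moreover have "dTV N D D' \<le> (\<Sum>x\<in>{1..N}. \<bar>pmf D x - g x\<bar>)"
  proof -
    have "(\<Sum>x\<in>{1..N}. \<bar>pmf D x - pmf D' x\<bar>) \<le>
          (\<Sum>x\<in>{1..N}. \<bar>pmf D x - g x\<bar> + g x * (\<bar>1 - s\<bar> / s))"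
    proof (rule sum_mono)
      fix x assume "x \<in> {1..N}"
      have "\<bar>g x - g x / s\<bar> = g x * (\<bar>1 - s\<bar> / s)"
      proof -
        have "g x - g x / s = g x * ((s - 1) / s)" using s by (simp add: field_simps)
        then show ?thesis using s g(2)[of x] by (simp add: abs_mult abs_minus_commute)
      qed
      moreover have "pmf D' x = g x / s" using \<open>x \<in> {1..N}\<close> by (simp add: D' p_def)
      ultimately show "\<bar>pmf D x - pmf D' x\<bar> \<le> \<bar>pmf D x - g x\<bar> + g x * (\<bar>1 - s\<bar> / s)"
        by linarith
    qed
    also have "\<dots> = (\<Sum>x\<in>{1..N}. \<bar>pmf D x - g x\<bar>) + \<bar>1 - s\<bar>"
      unfolding sum.distrib sum_distrib_right[symmetric] s_def[symmetric] using s by simp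
    finally show ?thesis using s1 by (simp add: dTV_def)
  qed
  ultimately show ?thesis by blast
qed

text \<open>The 24 is the 6 from \<open>partner_pair_violation\<close> times the 4 from
  \<open>ex_antimono_close\<close>. An approximating \<open>g\<close> closer than
  \<open>\<epsilon> < 1\<close> could be normalised to a monotone distribution that is too
  close.\<close>

lemma violation_far_ge:
  assumes D: "D \<in> distributions N" and \<epsilon>: "\<epsilon> < 1" and "b > 0"
    and far: "\<And>D'. D' \<in> monotone_distributions N \<Longrightarrow> dTV N D D' \<ge> \<epsilon>"
  shows "violation N b D \<ge> \<epsilon> / (24 * (real b + 1))"
proof -
  obtain g where g: "antimono g" "\<forall>x. g x \<ge> 0"
    "1 / (6 * (real b + 1)) * (\<Sum>x\<in>{1..N}. \<bar>pmf D x - g x\<bar>) \<le> 4 * violation N b D"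
    unfolding violation_def
    using ex_antimono_close[of "{1..N}" "pmf D" "1 / (6 * (real b + 1))" "\<lambda>x. pmf (partner b x)"]
      partner_pair_violation[of _ N _ _ b] \<open>b > 0\<close> by auto
  have "\<epsilon> \<le> (\<Sum>x\<in>{1..N}. \<bar>pmf D x - g x\<bar>)"
  proof (rule ccontr)
    assume *: "\<not> ?thesis"
    then obtain D' where "D' \<in> monotone_distributions N"
      "dTV N D D' \<le> (\<Sum>x\<in>{1..N}. \<bar>pmf D x - g x\<bar>)"
      using ex_monotone_distribution_close[OF D g(1)] g(2) \<epsilon> by force
    then show False using far * by force
  qed
  then have "1 / (6 * (real b + 1)) * \<epsilon> \<le> 1 / (6 * (real b + 1)) * (\<Sum>x\<in>{1..N}. \<bar>pmf D x - g x\<bar>)"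
    by (intro mult_left_mono) auto
  also note g(3)
  finally have "1 / (6 * (real b + 1)) * \<epsilon> \<le> 4 * violation N b D" .
  also have "1 / (6 * (real b + 1)) * \<epsilon> = 4 * (\<epsilon> / (24 * (real b + 1)))"
    by (simp del: distrib_left_numeral)
  finally show ?thesis by (rule mult_left_le_imp_le) simp
qed

section \<open>Choice of parameters\<close>

definition scales :: "real \<Rightarrow> nat" where "scales \<epsilon> = 4 * nat \<lceil>log 2 (1 / \<epsilon>)\<rceil> + 32"

text \<open>Half of the violation guaranteed for a far distribution.\<close>

definition gap :: "real \<Rightarrow> real" where "gap \<epsilon> = \<epsilon> / (48 * (real (scales \<epsilon>) + 1))"

text \<open>3840 is 30 * 128, which makes the Hoeffding exponent at least
  \<open>30 / gap \<epsilon>\<close>.\<close>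

definition tosses :: "real \<Rightarrow> nat" where "tosses \<epsilon> = nat \<lceil>3840 / gap \<epsilon> ^ 3\<rceil>"

definition rounds :: "real \<Rightarrow> nat" where "rounds \<epsilon> = nat \<lceil>4 / gap \<epsilon>\<rceil>"

definition tester :: "nat \<Rightarrow> real \<Rightarrow> query_alg" where
  "tester N \<epsilon> = trials N (scales \<epsilon>) (tosses \<epsilon>) (1/2 - 3 * gap \<epsilon> / 16) (rounds \<epsilon>)"

context
  fixes \<epsilon> :: real
  assumes \<epsilon>: "0 < \<epsilon>" "\<epsilon> < 1"
begin

lemma gap_bounds: "0 < gap \<epsilon>" "gap \<epsilon> \<le> 1"
proof -
  show "0 < gap \<epsilon>" using \<epsilon> by (simp add: gap_def)
  have "\<epsilon> \<le> 48 * (real (scales \<epsilon>) + 1)" using \<epsilon> by simp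
  then show "gap \<epsilon> \<le> 1" by (simp add: gap_def)
qed

lemma scales_le: "real (scales \<epsilon>) + 1 \<le> 37 * (1 + ln (1 / \<epsilon>))"
proof -
  have ln0: "ln (1 / \<epsilon>) \<ge> 0" using \<epsilon> by (intro ln_ge_zero) auto
  have "ln 2 \<ge> (1/2 :: real)" using ln2_ge_two_thirds by linarith
  then have "ln (1 / \<epsilon>) / ln 2 \<le> ln (1 / \<epsilon>) / (1/2)"
    using ln0 by (intro divide_left_mono) auto
  then have "log 2 (1 / \<epsilon>) \<le> 2 * ln (1 / \<epsilon>)" by (simp add: log_def)
  moreover have "log 2 (1 / \<epsilon>) \<ge> 0" using \<epsilon> by simp
  then have "real (nat \<lceil>log 2 (1 / \<epsilon>)\<rceil>) \<le> log 2 (1 / \<epsilon>) + 1" by linarith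
  \<comment> \<open>With \<open>L = ln (1 / \<epsilon>)\<close> the left side is at most
    \<open>4 * (2 * L + 1) + 33 = 37 + 8 * L\<close>.\<close>
  ultimately show ?thesis using ln0 by (simp add: scales_def)
qed

text \<open>\<open>gap\<close> itself depends on \<open>scales\<close>, so \<open>2 ^ scales\<close>
  has to beat both \<open>1 / \<epsilon>\<^sup>2\<close> and the square of
  \<open>scales + 1\<close>. Of the factor \<open>16 ^ n\<close>, one \<open>4 ^ n\<close> serves
  the former; the other, with \<open>2 ^ 32\<close>, serves the latter. The constant 276480 is
  \<open>120 * 48\<^sup>2\<close>.\<close>

lemma gap_scales: "1 / 2 ^ scales \<epsilon> \<le> (gap \<epsilon>)\<^sup>2 / 120"
proof -
  define n where "n = nat \<lceil>log 2 (1 / \<epsilon>)\<rceil>"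
  have b: "scales \<epsilon> = 4 * n + 32" by (simp add: scales_def n_def)
  have "log 2 (1 / \<epsilon>) \<le> n" unfolding n_def by linarith
  then have "1 / \<epsilon> \<le> 2 powr n" using \<epsilon> by (subst (asm) log_le_iff) auto
  then have "1 / \<epsilon> \<le> 2 ^ n" by (simp add: powr_realpow)
  then have n: "1 \<le> 2 ^ n * \<epsilon>" using \<epsilon> by (simp add: field_simps)
  have poly: "276480 * (4 * n + 33)\<^sup>2 \<le> 2 ^ 32 * 4 ^ n"
  proof (induction n)
    case (Suc n)
    have "(4 * Suc n + 33)\<^sup>2 \<le> 4 * (4 * n + 33)\<^sup>2" by (simp add: power2_eq_square algebra_simps)
    then show ?case using Suc by simp
  qed simp
  have "276480 * (real (scales \<epsilon>) + 1)\<^sup>2 = real (276480 * (4 * n + 33)\<^sup>2)"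
    by (simp add: b add_ac)
  also have "\<dots> \<le> real (2 ^ 32 * 4 ^ n)" using poly by (simp only: of_nat_le_iff)
  also have "\<dots> = 2 ^ 32 * 4 ^ n * 1\<^sup>2" by simp
  also have "\<dots> \<le> 2 ^ 32 * 4 ^ n * (2 ^ n * \<epsilon>)\<^sup>2"
    using n by (intro mult_left_mono power_mono) auto
  also have "\<dots> = 2 ^ scales \<epsilon> * \<epsilon>\<^sup>2"
  proof -
    have "2 ^ 32 * 4 ^ n * (2 ^ n)\<^sup>2 = (2::real) ^ (4 * n + 32)"
      by (simp add: power_add power_mult power2_eq_square flip: power_mult_distrib)
    then show ?thesis by (simp only: b power_mult_distrib mult.assoc[symmetric])
  qed
  finally have "276480 * (real (scales \<epsilon>) + 1)\<^sup>2 \<le> 2 ^ scales \<epsilon> * \<epsilon>\<^sup>2" .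
  moreover define B where "B = real (scales \<epsilon>) + 1"
  moreover have "B > 0" by (simp add: B_def)
  ultimately show ?thesis
    unfolding gap_def B_def[symmetric] by (simp add: field_simps)
qed

lemma tosses_ge: "real (tosses \<epsilon>) \<ge> 3840 / gap \<epsilon> ^ 3"
  unfolding tosses_def by linarith

lemma tosses_pos: "tosses \<epsilon> > 0"
  using gap_bounds by (simp add: tosses_def)

lemma error_le: "exp (- (tosses \<epsilon> * (gap \<epsilon>)\<^sup>2 / 128)) \<le> gap \<epsilon> / 30"
proof -
  have "30 / gap \<epsilon> = 3840 / gap \<epsilon> ^ 3 * (gap \<epsilon>)\<^sup>2 / 128"
    using gap_bounds by (simp add: power2_eq_square power3_eq_cube)
  also have "\<dots> \<le> tosses \<epsilon> * (gap \<epsilon>)\<^sup>2 / 128"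
    using tosses_ge by (intro divide_right_mono mult_right_mono) auto
  finally have "exp (- (tosses \<epsilon> * (gap \<epsilon>)\<^sup>2 / 128)) \<le> exp (- (30 / gap \<epsilon>))" by simp
  \<comment> \<open>From \<open>exp t \<ge> 1 + t\<close>, taken at
    \<open>t = 30 / gap \<epsilon>\<close>.\<close>
  also have "\<dots> \<le> inverse (30 / gap \<epsilon>)"
    unfolding exp_minus using exp_ge_add_one_self[of "30 / gap \<epsilon>"] gap_bounds
    by (intro le_imp_inverse_le) (linarith | simp)+
  finally show ?thesis by simp
qed

lemma rounds_bounds: "4 / gap \<epsilon> \<le> rounds \<epsilon>" "rounds \<epsilon> \<le> 5 / gap \<epsilon>"
proof -
  show "4 / gap \<epsilon> \<le> rounds \<epsilon>" unfolding rounds_def by linarith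
  have "1 \<le> 1 / gap \<epsilon>" using gap_bounds by simp
  moreover have "0 \<le> 4 / gap \<epsilon>" using gap_bounds by simp
  then have "real (rounds \<epsilon>) \<le> 4 / gap \<epsilon> + 1" unfolding rounds_def by linarith
  ultimately show "rounds \<epsilon> \<le> 5 / gap \<epsilon>" by simp
qed

section \<open>Error probabilities and query count of the tester\<close>

lemma tester_accepts:
  assumes "cond_oracle N D orc" "D \<in> monotone_distributions N" "N \<ge> 1"
  shows "pmf (run orc (tester N \<epsilon>)) ACCEPT \<ge> 2/3"
proof -
  let ?\<rho> = "pmf (trial N D (scales \<epsilon>) (tosses \<epsilon>) (1/2 - 3 * gap \<epsilon> / 16)) True"
  have D: "D \<in> distributions N" using assms by (simp add: monotone_distributions_def)
  have "?\<rho> \<le> exp (- (tosses \<epsilon> * (gap \<epsilon>)\<^sup>2 / 128)) + 4 / gap \<epsilon> * violation N (scales \<epsilon>) D"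
    by (intro pmf_trial_True_le D gap_bounds tosses_pos)
  \<comment> \<open>Statistical error and violation contribute \<open>gap \<epsilon> / 30\<close>
    each; over at most \<open>5 / gap \<epsilon>\<close> rounds this adds up to 1/3.\<close>
  also have "\<dots> \<le> gap \<epsilon> / 30 + 4 / gap \<epsilon> * ((gap \<epsilon>)\<^sup>2 / 120)"
    using error_le gap_bounds violation_monotone_le[OF assms(2), of "scales \<epsilon>"] gap_scales
    by (intro add_mono mult_left_mono) auto
  also have "\<dots> = gap \<epsilon> / 15" using gap_bounds by (simp add: power2_eq_square)
  finally have "rounds \<epsilon> * ?\<rho> \<le> 5 / gap \<epsilon> * (gap \<epsilon> / 15)"
    using rounds_bounds gap_bounds by (intro mult_mono) auto
  then have "rounds \<epsilon> * ?\<rho> \<le> 1/3" using gap_bounds by simp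
  \<comment> \<open>Bernoulli's inequality acts as the union bound over the rounds.\<close>
  moreover have "1 + real (rounds \<epsilon>) * (- ?\<rho>) \<le> (1 + (- ?\<rho>)) ^ rounds \<epsilon>"
    by (rule Bernoulli_inequality) (simp add: pmf_le_1)
  ultimately show ?thesis
    unfolding tester_def pmf_run_trials_ACCEPT[OF assms(1) D assms(3)] by simp
qed

lemma tester_rejects:
  assumes "cond_oracle N D orc" "D \<in> distributions N" "N \<ge> 1"
    and far: "\<And>D'. D' \<in> monotone_distributions N \<Longrightarrow> dTV N D D' \<ge> \<epsilon>"
  shows "pmf (run orc (tester N \<epsilon>)) REJECT \<ge> 2/3"
proof -
  let ?\<rho> = "pmf (trial N D (scales \<epsilon>) (tosses \<epsilon>) (1/2 - 3 * gap \<epsilon> / 16)) True"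
  let ?\<delta> = "exp (- (tosses \<epsilon> * (gap \<epsilon>)\<^sup>2 / 128))"
  have "violation N (scales \<epsilon>) D \<ge> \<epsilon> / (24 * (real (scales \<epsilon>) + 1))"
    using \<epsilon> far by (intro violation_far_ge assms(2)) (auto simp: scales_def)
  also have "\<epsilon> / (24 * (real (scales \<epsilon>) + 1)) = 2 * gap \<epsilon>"
    by (simp add: gap_def field_simps)
  \<comment> \<open>A violation of \<open>2 * gap \<epsilon>\<close> leaves
    \<open>gap \<epsilon>\<close> after the subtraction, and the error term is at most 1/2.\<close>
  finally have "1/2 * gap \<epsilon> \<le> (1 - ?\<delta>) * (violation N (scales \<epsilon>) D - gap \<epsilon>)"
    using error_le gap_bounds by (intro mult_mono) auto
  also have "\<dots> \<le> ?\<rho>" by (intro pmf_trial_True_ge assms gap_bounds tosses_pos)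
  finally have \<rho>: "gap \<epsilon> / 2 \<le> ?\<rho>" by simp
  have "2 = 4 / gap \<epsilon> * (gap \<epsilon> / 2)" using gap_bounds by simp
  also have "\<dots> \<le> rounds \<epsilon> * ?\<rho>"
    using rounds_bounds \<rho> gap_bounds by (intro mult_mono) auto
  finally have "2 \<le> rounds \<epsilon> * ?\<rho>" .
  have "(1 - ?\<rho>) ^ rounds \<epsilon> \<le> exp (- ?\<rho>) ^ rounds \<epsilon>"
    using exp_ge_add_one_self[of "- ?\<rho>"] by (intro power_mono) (auto simp: pmf_le_1)
  also have "\<dots> = exp (- (rounds \<epsilon> * ?\<rho>))" by (simp flip: exp_of_nat_mult)
  also have "\<dots> \<le> exp (- 2)" using \<open>2 \<le> rounds \<epsilon> * ?\<rho>\<close> by simp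
  also have "\<dots> \<le> inverse 3"
    unfolding exp_minus using exp_ge_add_one_self[of 2] by (intro le_imp_inverse_le) auto
  finally show ?thesis
    unfolding pmf_REJECT_conv_ACCEPT tester_def pmf_run_trials_ACCEPT[OF assms(1-3)] by simp
qed

lemma query_bound:
  "real (rounds \<epsilon> * (tosses \<epsilon> + 1)) \<le>
     (19210 * 48 ^ 4 * 37 ^ 4) * (1 / \<epsilon> ^ 4) * (1 + ln (1 / \<epsilon>)) ^ 4"
proof -
  have g: "1 \<le> 1 / gap \<epsilon> ^ 3" using gap_bounds by (simp add: power_le_one)
  have "real (tosses \<epsilon>) \<le> 3840 / gap \<epsilon> ^ 3 + 1"
    using g unfolding tosses_def by linarith
  \<comment> \<open>The rounding up and the query that draws \<open>x\<close> cost 1 each, both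
    absorbed by \<open>1 \<le> 1 / gap \<epsilon> ^ 3\<close>.\<close>
  then have "real (tosses \<epsilon> + 1) \<le> 3842 / gap \<epsilon> ^ 3" using g by simp
  then have "real (rounds \<epsilon>) * real (tosses \<epsilon> + 1) \<le> 5 / gap \<epsilon> * (3842 / gap \<epsilon> ^ 3)"
    using rounds_bounds gap_bounds by (intro mult_mono) auto
  also have "\<dots> = 19210 / gap \<epsilon> ^ 4"
    by (simp add: numeral_eq_Suc)
  also have "\<dots> = 19210 * 48 ^ 4 * (1 / \<epsilon> ^ 4) * (real (scales \<epsilon>) + 1) ^ 4"
    using \<epsilon> by (simp add: gap_def power_divide power_mult_distrib del: distrib_left_numeral)
  also have "\<dots> \<le> 19210 * 48 ^ 4 * (1 / \<epsilon> ^ 4) * (37 * (1 + ln (1 / \<epsilon>))) ^ 4"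
    using scales_le \<epsilon> by (intro mult_left_mono power_mono) auto
  finally show ?thesis by (simp only: of_nat_mult power_mult_distrib mult_ac)
qed

end

theorem theorem1p3:
  "\<exists>(A :: nat \<Rightarrow> real \<Rightarrow> query_alg) (q :: real \<Rightarrow> nat).
     (\<lambda>\<epsilon>. real (q \<epsilon>)) \<in> soft_O (\<lambda>\<epsilon>. 1 / \<epsilon> ^ 4) \<and>
     (\<forall>N \<ge> 1. \<forall>\<epsilon>\<in>{0<..<1}.
        queries_at_most N (A N \<epsilon>) (q \<epsilon>) \<and>
        (\<forall>D \<in> distributions N. \<forall>orc. cond_oracle N D orc \<longrightarrow>
           (D \<in> monotone_distributions N \<longrightarrow> pmf (run orc (A N \<epsilon>)) ACCEPT \<ge> 2/3) \<and>
           ((\<forall>D' \<in> monotone_distributions N. dTV N D D' \<ge> \<epsilon>) \<longrightarrow>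
              pmf (run orc (A N \<epsilon>)) REJECT \<ge> 2/3)))"
proof (intro exI conjI allI impI ballI)
  show "(\<lambda>\<epsilon>. real (rounds \<epsilon> * (tosses \<epsilon> + 1))) \<in> soft_O (\<lambda>\<epsilon>. 1 / \<epsilon> ^ 4)"
    unfolding soft_O_def
  proof (intro CollectI exI ballI)
    fix \<epsilon> :: real assume "\<epsilon> \<in> {0<..<1}"
    then show "\<bar>real (rounds \<epsilon> * (tosses \<epsilon> + 1))\<bar> \<le>
        (19210 * 48 ^ 4 * 37 ^ 4) * \<bar>1 / \<epsilon> ^ 4\<bar> * (1 + ln (1 / \<epsilon>)) ^ 4"
      using query_bound[of \<epsilon>] by simp
  qed
next
  fix N :: nat and \<epsilon> :: real
  assume "1 \<le> N" and "\<epsilon> \<in> {0<..<1}"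
  then show "queries_at_most N (tester N \<epsilon>) (rounds \<epsilon> * (tosses \<epsilon> + 1))"
    unfolding tester_def by (intro queries_at_most_trials)
next
  fix N :: nat and \<epsilon> :: real and D orc
  assume "1 \<le> N" "\<epsilon> \<in> {0<..<1}" "cond_oracle N D orc" "D \<in> monotone_distributions N"
  then show "pmf (run orc (tester N \<epsilon>)) ACCEPT \<ge> 2/3" by (intro tester_accepts) auto
next
  fix N :: nat and \<epsilon> :: real and D orc
  assume "1 \<le> N" "\<epsilon> \<in> {0<..<1}" "D \<in> distributions N" "cond_oracle N D orc"
    "\<forall>D' \<in> monotone_distributions N. dTV N D D' \<ge> \<epsilon>"
  then show "pmf (run orc (tester N \<epsilon>)) REJECT \<ge> 2/3" by (intro tester_rejects) auto
qed

end
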